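(* For every integer $n\ge 4$, the forgotten index of the third type of hex derived network $HDN3(n)$ is $$F(HDN3(n))=6\,(5339-8132n+3108n^2).$$
   Context: All graphs are finite, simple and undirected; $\kappa(p)$ denotes the degree of a vertex $p$ in a graph $G$. Hexagonal mesh $HX(n)$: the graph whose vertices are the integer triples $(x,y,z)$ with $x+y+z=0$ and $\max(|x|,|y|,|z|)\le n-1$, two vertices being adjacent iff their difference is a permutation of $(1,-1,0)$. (So $HX(2)$ consists of six triangles around a common vertex, and $HX(n)$ is obtained from $HX(n-1)$ by adding one layer of triangles around the boundary.) Third type of hex derived network $HDN3(n)$: obtained from $HX(n)$ by replacing each $K_3$ subgraph (triangle) of $HX(n)$ by a planar octahedron, once. That is, for each triangle with vertices $a,b,c$, all edges of the triangle are kept, three new vertices $u_{ab},u_{bc},u_{ca}$ (private to that triangle) are added, the new vertices are made pairwise adjacent, and $u_{ab}$ is joined to $a$ and $b$, $u_{bc}$ to $b$ and $c$, $u_{ca}$ to $c$ and $a$. Forgotten index: $F(G)=\sum_{pq\in E(G)}\big(\kappa(p)^2+\kappa(q)^2\big)$. *)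

theory Defs
  imports "HOL-Library.Multiset"
begin

record 'a graph =
  verts :: "'a set"
  edges :: "'a set set"

definition simple_graph :: "'a graph \<Rightarrow> bool" where
  "simple_graph G \<longleftrightarrow> finite (verts G) \<and> (\<forall>e\<in>edges G. e \<subseteq> verts G \<and> card e = 2)"

definition degree :: "'a graph \<Rightarrow> 'a \<Rightarrow> nat" where
  "degree G p = card {e \<in> edges G. p \<in> e}"

(* For a simple graph every edge e consists of two distinct vertices p, q, so the inner sum
   is (degree G p)^2 + (degree G q)^2. *)
definition forgotten_index :: "'a graph \<Rightarrow> nat" where
  "forgotten_index G = (\<Sum>e\<in>edges G. \<Sum>p\<in>e. (degree G p)\<^sup>2)"

definition HX_verts :: "nat \<Rightarrow> (int \<times> int \<times> int) set" where
  "HX_verts n = {(x, y, z). x + y + z = 0 \<and> max \<bar>x\<bar> (max \<bar>y\<bar> \<bar>z\<bar>) \<le> int n - 1}"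

fun HX_adj :: "int \<times> int \<times> int \<Rightarrow> int \<times> int \<times> int \<Rightarrow> bool" where
  "HX_adj (x, y, z) (x', y', z') \<longleftrightarrow> {# x - x', y - y', z - z' #} = {# 1, - 1, 0 #}"

definition HX :: "nat \<Rightarrow> (int \<times> int \<times> int) graph" where
  "HX n = \<lparr> verts = HX_verts n,
            edges = {{p, q} | p q. p \<in> HX_verts n \<and> q \<in> HX_verts n \<and> HX_adj p q} \<rparr>"

(* A K3 subgraph is determined by its vertex set. *)
definition triangles :: "'a graph \<Rightarrow> 'a set set" where
  "triangles G = {T. T \<subseteq> verts G \<and> card T = 3 \<and> (\<forall>p\<in>T. \<forall>q\<in>T. p \<noteq> q \<longrightarrow> {p, q} \<in> edges G)}"

definition sides :: "'a set \<Rightarrow> 'a set set" where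
  "sides T = {s. s \<subseteq> T \<and> card s = 2}"

(* New T {a, b} is the vertex u_ab private to the triangle T. *)
datatype 'a oct_vertex = Old 'a | New "'a set" "'a set"

definition octahedral_replacement :: "'a graph \<Rightarrow> 'a oct_vertex graph" where
  "octahedral_replacement G =
     \<lparr> verts = Old ` verts G \<union> {New T s | T s. T \<in> triangles G \<and> s \<in> sides T},
       edges = (\<lambda>e. Old ` e) ` edges G
         \<union> {{New T s, New T s'} | T s s'. T \<in> triangles G \<and> s \<in> sides T \<and> s' \<in> sides T \<and> s \<noteq> s'}
         \<union> {{New T s, Old p} | T s p. T \<in> triangles G \<and> s \<in> sides T \<and> p \<in> s} \<rparr>"

definition HDN3 :: "nat \<Rightarrow> (int \<times> int \<times> int) oct_vertex graph" where
  "HDN3 n = octahedral_replacement (HX n)"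

lemma simple_graph_HX: "simple_graph (HX n)"
proof -
  have "HX_verts n \<subseteq> {- int n..int n} \<times> {- int n..int n} \<times> {- int n..int n}"
    by (auto simp: HX_verts_def)
  then have "finite (HX_verts n)"
    by (rule finite_subset) simp
  moreover have "\<not> HX_adj p p" for p
    by (cases p) (auto dest: arg_cong[where f = "\<lambda>M. 1 \<in># M"])
  then have "card {p, q} = 2" if "HX_adj p q" for p q
    using that by (metis card_2_iff)
  ultimately show ?thesis
    by (auto simp: simple_graph_def HX_def simp del: HX_adj.simps)
qed

lemma simple_graph_octahedral_replacement:
  assumes "simple_graph G"
  shows "simple_graph (octahedral_replacement G)"
proof -
  have fin: "finite (verts G)"
    using assms by (simp add: simple_graph_def)
  have "{New T s | T s. T \<in> triangles G \<and> s \<in> sides T}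
      \<subseteq> (\<lambda>(T, s). New T s) ` (Pow (verts G) \<times> Pow (verts G))"
    by (force simp: triangles_def sides_def)
  then have "finite {New T s | T s. T \<in> triangles G \<and> s \<in> sides T}"
    by (rule finite_subset) (simp add: fin)
  moreover have "card (Old ` e) = 2" if "e \<in> edges G" for e
    using that assms by (simp add: simple_graph_def card_image inj_on_def)
  moreover have "e \<subseteq> verts G" if "e \<in> edges G" for e
    using that assms by (simp add: simple_graph_def)
  moreover have "p \<in> verts G" if "T \<in> triangles G" "s \<in> sides T" "p \<in> s" for T s p
    using that by (auto simp: triangles_def sides_def)
  ultimately show ?thesis
    unfolding simple_graph_def octahedral_replacement_def
    using fin by (auto simp: card_insert_if subset_iff)
qed

lemma simple_graph_HDN3: "simple_graph (HDN3 n)"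
  by (simp add: HDN3_def simple_graph_HX simple_graph_octahedral_replacement)

end

theory Submission
  imports Defs "HOL-Library.Product_Plus"
begin

text \<open>
  Each vertex \<open>p\<close> contributes the square of its degree once for every edge at \<open>p\<close>, so the
  forgotten index of a simple graph is the sum of the cubes of the degrees. Let a vertex \<open>p\<close> of a
  graph \<open>G\<close> have degree \<open>d\<close> and lie in \<open>t\<close> triangles. Octahedral replacement adds two edges at
  \<open>p\<close> for each of these triangles, so the degree of \<open>p\<close> becomes \<open>d + 2 t\<close>, while every new vertex has
  degree 4. A triangle has as many new vertices as old ones, so the number of new vertices is the sum
  of the \<open>t\<close> over all \<open>p\<close>. Hence the forgotten index after replacement is the sum of
  \<open>(d + 2 t)^3 + 64 t\<close> over the vertices of \<open>G\<close>
  (\<open>forgotten_index_octahedral_replacement\<close>), and the triangles themselves need not be counted.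

  In the hexagonal mesh the pair \<open>(d, t)\<close> is \<open>(6, 6)\<close> at the vertices of the next smaller mesh,
  \<open>(3, 2)\<close> at the six corners, and \<open>(4, 3)\<close> at the remaining boundary vertices
  (\<open>degree_and_triangles_HX\<close>). These vertices contribute 6216, 471 and 1192, respectively.
  Slicing the hexagon by lines shows that \<open>HX (m + 1)\<close> has \<open>3 m^2 + 3 m + 1\<close> vertices
  (\<open>card_HX_verts\<close>), which gives the size of each class and so the formula.
\<close>

section \<open>The forgotten index as a sum over vertices\<close>

text \<open>Exchange the two summations: the term of \<open>p\<close> occurs once for each of the edges at \<open>p\<close>.\<close>

lemma forgotten_index_eq_sum_cubes:
  assumes "simple_graph G"
  shows "forgotten_index G = (\<Sum>p\<in>verts G. degree G p ^ 3)"
proof -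
  have fin: "finite (verts G)" and sub: "\<And>e. e \<in> edges G \<Longrightarrow> e \<subseteq> verts G"
    using assms by (auto simp: simple_graph_def)
  have finE: "finite (edges G)"
    using sub fin by (meson PowI finite_Pow_iff finite_subset subsetI)
  have "forgotten_index G = (\<Sum>e\<in>edges G. \<Sum>p | p \<in> verts G \<and> p \<in> e. (degree G p)\<^sup>2)"
    unfolding forgotten_index_def using sub by (intro sum.cong refl) auto
  also have "\<dots> = (\<Sum>p\<in>verts G. \<Sum>e | e \<in> edges G \<and> p \<in> e. (degree G p)\<^sup>2)"
    by (rule sum.swap_restrict[OF finE fin])
  also have "\<dots> = (\<Sum>p\<in>verts G. degree G p ^ 3)"
    by (simp add: degree_def power2_eq_square power3_eq_cube mult.assoc)
  finally show ?thesis .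
qed

section \<open>Octahedral replacement\<close>

lemma card_sides: "card T = 3 \<Longrightarrow> card (sides T) = 3"
  using n_subsets[of T 2] by (simp add: sides_def card_ge_0_finite choose_two)

lemma finite_sides: "finite T \<Longrightarrow> finite (sides T)"
  by (simp add: sides_def)

lemma card_sides_containing:
  assumes "card T = 3" "p \<in> T"
  shows "card {s \<in> sides T. p \<in> s} = 2"
proof -
  have "bij_betw (\<lambda>q. {p, q}) (T - {p}) {s \<in> sides T. p \<in> s}"
    unfolding bij_betw_def
  proof
    show "inj_on (\<lambda>q. {p, q}) (T - {p})"
      by (auto simp: inj_on_def doubleton_eq_iff)
    have "s \<in> (\<lambda>q. {p, q}) ` (T - {p})" if s: "s \<subseteq> T" "card s = 2" "p \<in> s" for s
      using s by (auto simp: card_2_iff)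
    then show "(\<lambda>q. {p, q}) ` (T - {p}) = {s \<in> sides T. p \<in> s}"
      using assms by (auto simp: sides_def)
  qed
  then show ?thesis
    using assms bij_betw_same_card by fastforce
qed

definition triangles_at :: "'a graph \<Rightarrow> 'a \<Rightarrow> 'a set set" where
  "triangles_at G p = {T \<in> triangles G. p \<in> T}"

lemma finite_triangles: "finite (verts G) \<Longrightarrow> finite (triangles G)"
  by (rule finite_subset[of _ "Pow (verts G)"]) (auto simp: triangles_def)

text \<open>Double counting of the pairs of a triangle and one of its vertices.\<close>

lemma sum_card_triangles_at:
  assumes "finite (verts G)"
  shows "(\<Sum>p\<in>verts G. card (triangles_at G p)) = 3 * card (triangles G)"
proof -
  have "(\<Sum>p\<in>verts G. card (triangles_at G p))
      = (\<Sum>p\<in>verts G. \<Sum>T | T \<in> triangles G \<and> p \<in> T. 1)"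
    by (simp add: triangles_at_def)
  also have "\<dots> = (\<Sum>T\<in>triangles G. \<Sum>p | p \<in> verts G \<and> p \<in> T. 1)"
    by (rule sum.swap_restrict[OF assms finite_triangles[OF assms]])
  also have "\<dots> = (\<Sum>T\<in>triangles G. card T)"
  proof (intro sum.cong refl)
    fix T assume "T \<in> triangles G"
    then have "{p. p \<in> verts G \<and> p \<in> T} = T" by (auto simp: triangles_def)
    then show "(\<Sum>p | p \<in> verts G \<and> p \<in> T. 1) = card T" by simp
  qed
  also have "\<dots> = 3 * card (triangles G)"
    by (simp add: triangles_def)
  finally show ?thesis .
qed

text \<open>The new neighbours of \<open>p\<close> are the vertices for a side at \<open>p\<close> of a triangle at \<open>p\<close>, and each
  triangle has two such sides.\<close>

lemma degree_Old:
  assumes "simple_graph G"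
  shows "degree (octahedral_replacement G) (Old p) = degree G p + 2 * card (triangles_at G p)"
proof -
  let ?A = "(\<lambda>e. Old ` e) ` {e \<in> edges G. p \<in> e} :: 'a oct_vertex set set"
  let ?I = "SIGMA T : triangles_at G p. {s \<in> sides T. p \<in> s}"
  let ?B = "(\<lambda>(T, s). {New T s, Old p}) ` ?I"
  have fin: "finite (verts G)" and subE: "edges G \<subseteq> Pow (verts G)"
    using assms by (auto simp: simple_graph_def)
  have finE: "finite (edges G)"
    using subE fin by (meson finite_Pow_iff finite_subset)
  have finT: "finite (triangles_at G p)"
    using finite_triangles[OF fin] by (simp add: triangles_at_def)
  have T3: "card T = 3" "p \<in> T" if "T \<in> triangles_at G p" for T
    using that by (auto simp: triangles_at_def triangles_def)
  have finS: "finite (sides T)" if "T \<in> triangles_at G p" for T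
    using T3[OF that] by (intro finite_sides) (simp add: card_ge_0_finite)
  have eq: "{e \<in> edges (octahedral_replacement G). Old p \<in> e} = ?A \<union> ?B"
    by (auto simp: octahedral_replacement_def triangles_at_def sides_def image_iff)
  have "?A \<inter> ?B = {}" by auto
  moreover have "finite ?A" using finE by simp
  moreover have "finite ?B" using finT finS by (intro finite_imageI finite_SigmaI) auto
  moreover have "card ?A = degree G p"
    unfolding degree_def by (intro card_image inj_onI) (auto simp: inj_image_eq_iff inj_on_def)
  moreover have "card ?B = card ?I"
    by (intro card_image) (auto simp: inj_on_def doubleton_eq_iff)
  moreover have "card ?I = (\<Sum>T\<in>triangles_at G p. card {s \<in> sides T. p \<in> s})"
    using finT finS by (intro card_SigmaI) auto
  moreover have "\<dots> = 2 * card (triangles_at G p)"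
    by (simp add: card_sides_containing T3)
  ultimately show ?thesis
    unfolding degree_def[of "octahedral_replacement G"] eq by (simp add: card_Un_disjoint)
qed

text \<open>The neighbours of a new vertex are the vertices for the other two sides of its triangle and the
  two end points of its own side.\<close>

lemma degree_New:
  assumes T: "T \<in> triangles G" and s: "s \<in> sides T"
  shows "degree (octahedral_replacement G) (New T s) = 4"
proof -
  let ?A = "(\<lambda>s'. {New T s, New T s'}) ` (sides T - {s})"
  let ?B = "(\<lambda>p. {New T s, Old p}) ` s"
  have T3: "card T = 3" using T by (simp add: triangles_def)
  then have finT: "finite T" by (simp add: card_ge_0_finite)
  have fins: "finite s" using s finT by (auto simp: sides_def dest: finite_subset)
  have eq: "{e \<in> edges (octahedral_replacement G). New T s \<in> e} = ?A \<union> ?B"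
    using T s by (auto simp: octahedral_replacement_def image_iff doubleton_eq_iff)
  have "?A \<inter> ?B = {}" by (auto simp: doubleton_eq_iff)
  moreover have "finite ?A" "finite ?B" using finite_sides[OF finT] fins by auto
  moreover have "card ?A = card (sides T - {s})"
    by (intro card_image) (auto simp: inj_on_def doubleton_eq_iff)
  moreover have "card (sides T - {s}) = 2"
    using s card_sides[OF T3] by simp
  moreover have "card ?B = card s"
    by (intro card_image) (auto simp: inj_on_def doubleton_eq_iff)
  moreover have "card s = 2" using s by (simp add: sides_def)
  ultimately show ?thesis
    unfolding degree_def eq by (simp add: card_Un_disjoint)
qed

text \<open>The new vertices contribute \<open>4^3\<close> each; since there are three per triangle, double counting
  moves this contribution to the old vertices, with one share for each triangle at the vertex.\<close>

lemma forgotten_index_octahedral_replacement: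
  assumes "simple_graph G"
  shows "forgotten_index (octahedral_replacement G)
    = (\<Sum>p\<in>verts G. (degree G p + 2 * card (triangles_at G p)) ^ 3 + 64 * card (triangles_at G p))"
proof -
  let ?H = "octahedral_replacement G"
  let ?I = "Sigma (triangles G) sides"
  have fin: "finite (verts G)" using assms by (simp add: simple_graph_def)
  have T3: "card T = 3" if "T \<in> triangles G" for T using that by (simp add: triangles_def)
  have finS: "finite (sides T)" if "T \<in> triangles G" for T
    using T3[OF that] by (intro finite_sides) (simp add: card_ge_0_finite)
  have finI: "finite ?I"
    using finite_triangles[OF fin] finS by (intro finite_SigmaI) auto
  have V: "verts ?H = Old ` verts G \<union> (\<lambda>(T, s). New T s) ` ?I"
    by (auto simp: octahedral_replacement_def)
  have "(\<Sum>v\<in>verts ?H. degree ?H v ^ 3)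
    = (\<Sum>v\<in>Old ` verts G. degree ?H v ^ 3) + (\<Sum>v\<in>(\<lambda>(T, s). New T s) ` ?I. degree ?H v ^ 3)"
    unfolding V using fin finI by (intro sum.union_disjoint) auto
  also have "(\<Sum>v\<in>Old ` verts G. degree ?H v ^ 3)
    = (\<Sum>p\<in>verts G. (degree G p + 2 * card (triangles_at G p)) ^ 3)"
    by (subst sum.reindex) (auto simp: inj_on_def degree_Old[OF assms])
  also have "(\<Sum>v\<in>(\<lambda>(T, s). New T s) ` ?I. degree ?H v ^ 3) = (\<Sum>i\<in>?I. 4 ^ 3)"
    by (subst sum.reindex) (auto simp: inj_on_def degree_New simp del: sum_constant intro!: sum.cong)
  also have "\<dots> = 64 * card ?I" by simp
  also have "card ?I = (\<Sum>T\<in>triangles G. card (sides T))"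
    using finite_triangles[OF fin] finS by (intro card_SigmaI) auto
  also have "\<dots> = 3 * card (triangles G)"
    by (simp add: T3 card_sides)
  also have "\<dots> = (\<Sum>p\<in>verts G. card (triangles_at G p))"
    by (rule sum_card_triangles_at[OF fin, symmetric])
  finally show ?thesis
    by (simp add: forgotten_index_eq_sum_cubes simple_graph_octahedral_replacement assms
        sum.distrib sum_distrib_left)
qed

section \<open>Degrees and triangles in the hexagonal mesh\<close>

definition hex_dirs :: "(int \<times> int \<times> int) set" where
  "hex_dirs = {(1, -1, 0), (1, 0, -1), (0, 1, -1), (-1, 1, 0), (-1, 0, 1), (0, -1, 1)}"

text \<open>Rotation of the triangular lattice by 60 degrees. It permutes \<open>hex_dirs\<close> cyclically, so that
  \<open>e\<close> and \<open>hex_rot e\<close> span a triangle of the lattice.\<close>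

fun hex_rot :: "int \<times> int \<times> int \<Rightarrow> int \<times> int \<times> int" where
  "hex_rot (x, y, z) = (- y, - z, - x)"

lemma hex_dirs_uminus: "- e \<in> hex_dirs \<longleftrightarrow> e \<in> hex_dirs"
proof -
  have *: "- f \<in> hex_dirs" if "f \<in> hex_dirs" for f
    using that unfolding hex_dirs_def by (elim insertE emptyE) simp_all
  show ?thesis
    using *[of e] *[of "- e"] by auto
qed

lemma mset_eq_unit_difference_iff:
  "{#a, b, c#} = {#1, -1, 0#} \<longleftrightarrow> (a, b, c) \<in> hex_dirs" for a b c :: int
proof
  assume "{#a, b, c#} = {#1, -1, 0#}"
  from arg_cong[OF this, of set_mset] have "{a, b, c} = {1, -1, 0}"
    unfolding set_mset_add_mset_insert set_mset_empty .
  then have in3: "a \<in> {1, -1, 0}" "b \<in> {1, -1, 0}" "c \<in> {1, -1, 0}"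
    and ex3: "1 \<in> {a, b, c}" "-1 \<in> {a, b, c}" "0 \<in> {a, b, c}"
    by blast+
  from in3 show "(a, b, c) \<in> hex_dirs"
    unfolding hex_dirs_def by (elim insertE emptyE) (use ex3 in simp_all)
next
  assume "(a, b, c) \<in> hex_dirs"
  then show "{#a, b, c#} = {#1, -1, 0#}"
    unfolding hex_dirs_def by (elim insertE emptyE) (simp_all add: add_mset_commute)
qed

lemma HX_adj_iff: "HX_adj p q \<longleftrightarrow> q - p \<in> hex_dirs"
proof -
  have "HX_adj p q \<longleftrightarrow> p - q \<in> hex_dirs"
    by (cases p; cases q) (simp add: mset_eq_unit_difference_iff)
  then show ?thesis
    using hex_dirs_uminus[of "q - p"] by simp
qed

lemma hex_rot_dirs: "e \<in> hex_dirs \<Longrightarrow> hex_rot e \<in> hex_dirs \<and> hex_rot e - e \<in> hex_dirs"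
  by (auto simp: hex_dirs_def)

text \<open>Two unit directions differ by a unit direction only if the angle between them is 60 degrees.\<close>

lemma hex_dirs_diff:
  "\<lbrakk>e \<in> hex_dirs; f \<in> hex_dirs; f - e \<in> hex_dirs\<rbrakk> \<Longrightarrow> f = hex_rot e \<or> e = hex_rot f"
  by (auto simp: hex_dirs_def zero_prod_def)

lemma hex_dirs_neq: "e \<in> hex_dirs \<Longrightarrow> e \<noteq> 0 \<and> hex_rot e \<noteq> e \<and> hex_rot e \<noteq> 0 \<and> hex_rot (hex_rot e) \<noteq> e"
  by (auto simp: hex_dirs_def zero_prod_def)

lemma edge_HX_iff:
  "{p, q} \<in> edges (HX n) \<longleftrightarrow> p \<in> HX_verts n \<and> q \<in> HX_verts n \<and> q - p \<in> hex_dirs"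
  using hex_dirs_uminus[of "q - p"]
  by (auto simp: HX_def HX_adj_iff doubleton_eq_iff simp del: split_paired_Ex)

lemma degree_HX:
  assumes "p \<in> HX_verts n"
  shows "degree (HX n) p = card {e \<in> hex_dirs. p + e \<in> HX_verts n}"
proof -
  have "bij_betw (\<lambda>e. {p, p + e}) {e \<in> hex_dirs. p + e \<in> HX_verts n} {e \<in> edges (HX n). p \<in> e}"
    unfolding bij_betw_def
  proof
    show "inj_on (\<lambda>e. {p, p + e}) {e \<in> hex_dirs. p + e \<in> HX_verts n}"
      by (auto simp: inj_on_def doubleton_eq_iff)
    have "E \<in> (\<lambda>e. {p, p + e}) ` {e \<in> hex_dirs. p + e \<in> HX_verts n}"
      if E: "E \<in> edges (HX n)" "p \<in> E" for E
    proof -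
      obtain q where q: "E = {p, q}"
        using E by (auto simp: HX_def simp del: split_paired_Ex)
      show ?thesis
        using E q edge_HX_iff[of p q n] by (intro image_eqI[of _ _ "q - p"]) auto
    qed
    then show "(\<lambda>e. {p, p + e}) ` {e \<in> hex_dirs. p + e \<in> HX_verts n} = {e \<in> edges (HX n). p \<in> e}"
      using assms by (auto simp: edge_HX_iff)
  qed
  then show ?thesis
    by (simp add: degree_def bij_betw_same_card)
qed

text \<open>The other two vertices of a triangle at \<open>p\<close> lie in directions that are 60 degrees apart, so the
  triangle is given uniquely by the first of the two directions in the cyclic order.\<close>

lemma card_triangles_at_HX:
  assumes p: "p \<in> HX_verts n"
  shows "card (triangles_at (HX n) p)
    = card {e \<in> hex_dirs. p + e \<in> HX_verts n \<and> p + hex_rot e \<in> HX_verts n}"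
proof -
  let ?D = "{e \<in> hex_dirs. p + e \<in> HX_verts n \<and> p + hex_rot e \<in> HX_verts n}"
  let ?f = "\<lambda>e. {p, p + e, p + hex_rot e}"
  have "bij_betw ?f ?D (triangles_at (HX n) p)"
    unfolding bij_betw_def
  proof
    show "inj_on ?f ?D"
    proof (rule inj_onI)
      fix e f assume e: "e \<in> ?D" and f: "f \<in> ?D" and "?f e = ?f f"
      have nz: "e \<noteq> 0" "hex_rot e \<noteq> 0" "f \<noteq> 0" "hex_rot f \<noteq> 0"
        using e f hex_dirs_neq by auto
      have "?f e - {p} = {p + e, p + hex_rot e}" "?f f - {p} = {p + f, p + hex_rot f}"
        using nz by auto
      with \<open>?f e = ?f f\<close> have "{p + e, p + hex_rot e} = {p + f, p + hex_rot f}"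
        by metis
      then show "e = f"
        using hex_dirs_neq[of e] e by (auto simp: doubleton_eq_iff)
    qed
    have in_tri: "?f e \<in> triangles_at (HX n) p" if e: "e \<in> ?D" for e
    proof -
      have "card (?f e) = 3" using e hex_dirs_neq[of e] by auto
      moreover have "{a, b} \<in> edges (HX n)" if "a \<in> ?f e" "b \<in> ?f e" "a \<noteq> b" for a b
        using that e p hex_rot_dirs[of e] hex_dirs_uminus[of e] hex_dirs_uminus[of "hex_rot e"]
          hex_dirs_uminus[of "hex_rot e - e"]
        by (auto simp: edge_HX_iff)
      moreover have "?f e \<subseteq> verts (HX n)" using e p by (auto simp: HX_def)
      ultimately show ?thesis by (auto simp: triangles_at_def triangles_def)
    qed
    have "T \<in> ?f ` ?D" if T: "T \<in> triangles_at (HX n) p" for T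
    proof -
      have T': "card T = 3" "p \<in> T" "\<And>a b. a \<in> T \<Longrightarrow> b \<in> T \<Longrightarrow> a \<noteq> b \<Longrightarrow> {a, b} \<in> edges (HX n)"
        using T by (auto simp: triangles_at_def triangles_def)
      then have "card (T - {p}) = 2" by simp
      then obtain q r where "T - {p} = {q, r}" "q \<noteq> r" by (auto simp: card_2_iff)
      then have qr: "T = {p, q, r}" "p \<noteq> q" "p \<noteq> r" "q \<noteq> r" using T'(2) by auto
      have *: "q \<in> HX_verts n" "r \<in> HX_verts n" "q - p \<in> hex_dirs" "r - p \<in> hex_dirs" "r - q \<in> hex_dirs"
        using T'(3)[of p q] T'(3)[of p r] T'(3)[of q r] qr by (auto simp: edge_HX_iff)
      have "r - p = hex_rot (q - p) \<or> q - p = hex_rot (r - p)"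
        using hex_dirs_diff[of "q - p" "r - p"] * by simp
      then show ?thesis
      proof
        assume h: "r - p = hex_rot (q - p)"
        then show ?thesis using * qr
          by (intro image_eqI[of _ _ "q - p"]) (auto simp flip: h)
      next
        assume h: "q - p = hex_rot (r - p)"
        then show ?thesis using * qr
          by (intro image_eqI[of _ _ "r - p"]) (auto simp flip: h)
      qed
    qed
    then show "?f ` ?D = triangles_at (HX n) p" using in_tri by blast
  qed
  then show ?thesis by (simp add: bij_betw_same_card)
qed

definition hex_corners :: "nat \<Rightarrow> (int \<times> int \<times> int) set" where
  "hex_corners n = (\<lambda>(x, y, z). ((int n - 1) * x, (int n - 1) * y, (int n - 1) * z)) ` hex_dirs"

lemma card_filter_hex_dirs:
  "card {e \<in> hex_dirs. P e} = of_bool (P (1, -1, 0)) + of_bool (P (1, 0, -1)) + of_bool (P (0, 1, -1))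
    + of_bool (P (-1, 1, 0)) + of_bool (P (-1, 0, 1)) + of_bool (P (0, -1, 1))"
proof -
  have "card {e \<in> hex_dirs. P e} = (\<Sum>e\<in>hex_dirs. of_bool (P e))"
    by (simp add: hex_dirs_def Int_def flip: sum.inter_filter)
  then show ?thesis by (simp add: hex_dirs_def)
qed

text \<open>
  A step from \<open>p\<close> raises one coordinate and lowers another one, so it stays in the mesh iff the first
  is not yet at its maximum \<open>M\<close> and the second is not yet at its minimum \<open>- M\<close>. Everything therefore
  depends on which of the six bounds are attained at \<open>p\<close>: none in the interior, one inside a side of
  the hexagon, and two at a corner.
\<close>

lemma degree_and_triangles_HX:
  assumes n: "n \<ge> 2" and p: "p \<in> HX_verts n"
  shows "p \<in> HX_verts (n - 1) \<Longrightarrow> degree (HX n) p = 6 \<and> card (triangles_at (HX n) p) = 6"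
    and "p \<in> hex_corners n \<Longrightarrow> degree (HX n) p = 3 \<and> card (triangles_at (HX n) p) = 2"
    and "p \<notin> HX_verts (n - 1) \<Longrightarrow> p \<notin> hex_corners n
      \<Longrightarrow> degree (HX n) p = 4 \<and> card (triangles_at (HX n) p) = 3"
proof -
  obtain x y z where xyz: "p = (x, y, z)" by (cases p)
  define M where "M = int n - 1"
  have M: "M \<ge> 1" using n by (simp add: M_def)
  have V: "(a, b, c) \<in> HX_verts n \<longleftrightarrow> a + b + c = 0 \<and> \<bar>a\<bar> \<le> M \<and> \<bar>b\<bar> \<le> M \<and> \<bar>c\<bar> \<le> M" for a b c
    by (auto simp: HX_verts_def M_def)
  have V': "(a, b, c) \<in> HX_verts (n - 1) \<longleftrightarrow> a + b + c = 0 \<and> \<bar>a\<bar> < M \<and> \<bar>b\<bar> < M \<and> \<bar>c\<bar> < M" for a b c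
    using n by (auto simp: HX_verts_def M_def of_nat_diff)
  have sum0: "x + y + z = 0" and b: "- M \<le> x" "x \<le> M" "- M \<le> y" "y \<le> M" "- M \<le> z" "z \<le> M"
    using p by (auto simp: xyz V)
  have steps:
    "p + (1, -1, 0) \<in> HX_verts n \<longleftrightarrow> x < M \<and> - M < y"
    "p + (1, 0, -1) \<in> HX_verts n \<longleftrightarrow> x < M \<and> - M < z"
    "p + (0, 1, -1) \<in> HX_verts n \<longleftrightarrow> y < M \<and> - M < z"
    "p + (-1, 1, 0) \<in> HX_verts n \<longleftrightarrow> y < M \<and> - M < x"
    "p + (-1, 0, 1) \<in> HX_verts n \<longleftrightarrow> z < M \<and> - M < x"
    "p + (0, -1, 1) \<in> HX_verts n \<longleftrightarrow> z < M \<and> - M < y"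
    unfolding xyz add_Pair V using sum0 b by linarith+
  have deg: "degree (HX n) p = of_bool (x < M \<and> - M < y) + of_bool (x < M \<and> - M < z)
      + of_bool (y < M \<and> - M < z) + of_bool (y < M \<and> - M < x)
      + of_bool (z < M \<and> - M < x) + of_bool (z < M \<and> - M < y)"
    unfolding degree_HX[OF p] card_filter_hex_dirs steps ..
  \<comment> \<open>Directions 60 degrees apart share either the raised or the lowered coordinate, so that a
    triangle depends on three bounds.\<close>
  have tri: "card (triangles_at (HX n) p) =
      of_bool (x < M \<and> - M < y \<and> - M < z) + of_bool (x < M \<and> y < M \<and> - M < z)
      + of_bool (y < M \<and> - M < z \<and> - M < x) + of_bool (y < M \<and> z < M \<and> - M < x)
      + of_bool (z < M \<and> - M < x \<and> - M < y) + of_bool (z < M \<and> x < M \<and> - M < y)"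
    unfolding card_triangles_at_HX[OF p] card_filter_hex_dirs hex_rot.simps minus_minus minus_zero steps
    by (intro arg_cong2[of _ _ _ _ "(+)"] arg_cong[of _ _ of_bool]) blast+
  have corner_iff: "p \<in> hex_corners n \<longleftrightarrow>
      (x = M \<and> y = - M \<and> z = 0) \<or> (x = M \<and> y = 0 \<and> z = - M) \<or> (x = 0 \<and> y = M \<and> z = - M)
      \<or> (x = - M \<and> y = M \<and> z = 0) \<or> (x = - M \<and> y = 0 \<and> z = M) \<or> (x = 0 \<and> y = - M \<and> z = M)"
    by (simp add: hex_corners_def hex_dirs_def xyz flip: M_def)
  show "degree (HX n) p = 6 \<and> card (triangles_at (HX n) p) = 6" if "p \<in> HX_verts (n - 1)"
  proof -
    have "- M < x" "x < M" "- M < y" "y < M" "- M < z" "z < M"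
      using that unfolding xyz V' by auto
    then show ?thesis by (simp add: deg tri)
  qed
  show "degree (HX n) p = 3 \<and> card (triangles_at (HX n) p) = 2" if "p \<in> hex_corners n"
    using that[unfolded corner_iff] M unfolding deg tri by (elim disjE conjE) simp_all
  show "degree (HX n) p = 4 \<and> card (triangles_at (HX n) p) = 3"
    if "p \<notin> HX_verts (n - 1)" "p \<notin> hex_corners n"
  proof -
    \<comment> \<open>A maximum and a minimum attained together leave 0 for the third coordinate and make \<open>p\<close> a
      corner. Two maxima or two minima would push the third coordinate out of range.\<close>
    have nc: "\<not> (x = M \<and> y = - M)" "\<not> (x = M \<and> z = - M)" "\<not> (y = M \<and> z = - M)"
      "\<not> (x = - M \<and> y = M)" "\<not> (x = - M \<and> z = M)" "\<not> (y = - M \<and> z = M)"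
      using that(2) sum0 unfolding corner_iff by auto
    have "\<not> (\<bar>x\<bar> < M \<and> \<bar>y\<bar> < M \<and> \<bar>z\<bar> < M)"
      using that(1) sum0 unfolding xyz V' by simp
    then consider "x = M" | "x = - M" | "y = M" | "y = - M" | "z = M" | "z = - M"
      using b by linarith
    then show ?thesis
    proof cases
      case 1
      then have "- M < y" "y < M" "- M < z" "z < M" using nc b sum0 M by linarith+
      with 1 M show ?thesis by (simp add: deg tri)
    next
      case 2
      then have "- M < y" "y < M" "- M < z" "z < M" using nc b sum0 M by linarith+
      with 2 M show ?thesis by (simp add: deg tri)
    next
      case 3
      then have "- M < x" "x < M" "- M < z" "z < M" using nc b sum0 M by linarith+
      with 3 M show ?thesis by (simp add: deg tri)
    next
      case 4
      then have "- M < x" "x < M" "- M < z" "z < M" using nc b sum0 M by linarith+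
      with 4 M show ?thesis by (simp add: deg tri)
    next
      case 5
      then have "- M < x" "x < M" "- M < y" "y < M" using nc b sum0 M by linarith+
      with 5 M show ?thesis by (simp add: deg tri)
    next
      case 6
      then have "- M < x" "x < M" "- M < y" "y < M" using nc b sum0 M by linarith+
      with 6 M show ?thesis by (simp add: deg tri)
    qed
  qed
qed

section \<open>Counting vertices of the hexagonal mesh\<close>

text \<open>The line with a fixed first coordinate \<open>x\<close> meets the hexagon of side length \<open>m\<close> in
  \<open>2 m + 1 - |x|\<close> vertices.\<close>

lemma card_HX_verts: "int (card (HX_verts (Suc m))) = 3 * (int m)\<^sup>2 + 3 * int m + 1"
proof -
  let ?M = "int m"
  let ?Y = "\<lambda>x. {max (-?M) (-?M - x)..min ?M (?M - x)}"
  have "HX_verts (Suc m) = (\<lambda>(x, y). (x, y, - x - y)) ` (SIGMA x : {-?M..?M}. ?Y x)"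
    by (force simp: HX_verts_def image_iff)
  moreover have "inj_on (\<lambda>(x, y). (x, y, - x - y)) (SIGMA x : {-?M..?M}. ?Y x)"
    by (auto simp: inj_on_def)
  ultimately have "card (HX_verts (Suc m)) = (\<Sum>x\<in>{-?M..?M}. card (?Y x))"
    by (simp add: card_image)
  then have "int (card (HX_verts (Suc m))) = (\<Sum>x\<in>{-?M..?M}. int (card (?Y x)))"
    by simp
  also have "\<dots> = (\<Sum>x\<in>{-?M..?M}. 2 * ?M + 1 - \<bar>x\<bar>)"
    by (intro sum.cong) (auto simp: max_def min_def)
  also have "\<dots> = (2 * ?M + 1)\<^sup>2 - (\<Sum>x\<in>{-?M..?M}. \<bar>x\<bar>)"
    by (simp add: sum_subtractf power2_eq_square)
  also have "(\<Sum>x\<in>{-?M..?M}. \<bar>x\<bar>) = ?M * (?M + 1)"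
  proof (induction m)
    case (Suc m)
    have "{- int (Suc m)..int (Suc m)} = insert (int (Suc m)) (insert (- int (Suc m)) {-int m..int m})"
      by auto
    with Suc show ?case by (simp add: algebra_simps)
  qed simp
  finally show ?thesis by (simp add: power2_eq_square algebra_simps)
qed

lemma card_hex_corners: "n \<ge> 2 \<Longrightarrow> card (hex_corners n) = 6"
  unfolding hex_corners_def by (subst card_image) (auto simp: inj_on_def hex_dirs_def)

lemma hex_corners_subset: "n \<ge> 2 \<Longrightarrow> hex_corners n \<subseteq> HX_verts n - HX_verts (n - 1)"
  by (auto simp: hex_corners_def hex_dirs_def HX_verts_def)

section \<open>The forgotten index of the third type of hex derived network\<close>

theorem theorem2p1p1:
  fixes n :: nat
  assumes "n \<ge> 4"
  shows "int (forgotten_index (HDN3 n)) = 6 * (5339 - 8132 * int n + 3108 * (int n)\<^sup>2)"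
proof -
  let ?w = "\<lambda>p. (degree (HX n) p + 2 * card (triangles_at (HX n) p)) ^ 3
    + 64 * card (triangles_at (HX n) p)"
  let ?V = "HX_verts n" and ?I = "HX_verts (n - 1)" and ?C = "hex_corners n"
  have n: "n \<ge> 2" using assms by simp
  have fin: "finite ?V" using simple_graph_HX[of n] by (simp add: simple_graph_def HX_def)
  have IV: "?I \<subseteq> ?V" by (auto simp: HX_verts_def)
  have CV: "?C \<subseteq> ?V - ?I" using hex_corners_subset[OF n] .
  have "forgotten_index (HDN3 n) = (\<Sum>p\<in>?V. ?w p)"
    by (simp add: HDN3_def forgotten_index_octahedral_replacement simple_graph_HX)
      (simp add: HX_def)
  also have "\<dots> = (\<Sum>p\<in>?V - ?I - ?C. ?w p) + (\<Sum>p\<in>?C. ?w p) + (\<Sum>p\<in>?I. ?w p)"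
    by (simp only: sum.subset_diff[OF IV fin] sum.subset_diff[OF CV finite_Diff[OF fin]])
  \<comment> \<open>The values are \<open>10^3 + 64 * 3\<close>, \<open>7^3 + 64 * 2\<close> and \<open>18^3 + 64 * 6\<close>.\<close>
  also have "(\<Sum>p\<in>?V - ?I - ?C. ?w p) = (\<Sum>p\<in>?V - ?I - ?C. 1192)"
    by (intro sum.cong refl) (simp add: degree_and_triangles_HX(3)[OF n])
  also have "(\<Sum>p\<in>?C. ?w p) = (\<Sum>p\<in>?C. 471)"
    using CV by (intro sum.cong refl) (auto simp: degree_and_triangles_HX(2)[OF n])
  also have "(\<Sum>p\<in>?I. ?w p) = (\<Sum>p\<in>?I. 6216)"
    using IV by (intro sum.cong refl) (auto simp: degree_and_triangles_HX(1)[OF n])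
  finally have F: "forgotten_index (HDN3 n) = 1192 * card (?V - ?I - ?C) + 471 * card ?C + 6216 * card ?I"
    by simp
  have cC: "card ?C = 6" by (rule card_hex_corners[OF n])
  have "card ?V = card (?V - ?I - ?C) + card ?C + card ?I"
    using fin IV CV by (metis (no_types, lifting) card_Diff_subset card_mono finite_Diff finite_subset
      le_add_diff_inverse2)
  then have cS: "int (card (?V - ?I - ?C)) = int (card ?V) - 6 - int (card ?I)"
    by (simp add: cC)
  obtain k where k: "n = Suc (Suc k)"
    using n by (metis add_2_eq_Suc le_Suc_ex)
  show ?thesis
    unfolding F using cS cC card_HX_verts[of "Suc k"] card_HX_verts[of k]
    by (simp add: k power2_eq_square algebra_simps)
qed

end
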